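(* Let $1<p,q<\infty$. Let $\mu,\lambda$ be two finite Borel measures on the LCA group $G$ and let $\nu$ be a Borel measure on $\widehat{G}$. Let $\nu$ be a $(p,q)$-frame measure for $\mu$ with frame bounds $A,B$, and let $S:L^p(\lambda)\to L^p(\mu)$ be a bounded invertible operator. Choose $C,D,M\ge0$ such that $\max\left\{C+\frac{M}{\sqrt[q]{A}\,\|S^{-1}\|^{-1}},\,D\right\}<1$. Further, let $$\|\widehat{S(f)d\mu}-\widehat{fd\lambda}\|_{L^q(\nu)}\le C\|\widehat{S(f)d\mu}\|_{L^q(\nu)}+D\|\widehat{fd\lambda}\|_{L^q(\nu)}+M\|f\|_{L^p(\lambda)}$$ for all $f\in L^p(\lambda)$. Then $\nu$ is a $(p,q)$-frame measure for $\lambda$ with frame bounds $$A\|S^{-1}\|^{-q}\left(1-\frac{C+D+\frac{M}{\sqrt[q]{A}\|S^{-1}\|^{-1}}}{1+D}\right)^q\quad\text{and}\quad B\|S\|^q\left(1+\frac{C+D+\frac{M}{\sqrt[q]{B}\|S\|}}{1-D}\right)^q.$$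
   Context: $G$ is a locally compact Hausdorff abelian (LCA) group, written additively, which is metrizable and a countable union of compact sets; $\widehat{G}$ is its dual group (continuous characters), and $\langle x,\gamma\rangle$ denotes the value of $\gamma\in\widehat{G}$ at $x\in G$. For a finite Borel measure $\mu$ on $G$ and $f\in L^1(\mu)$, $\widehat{fd\mu}(\gamma)=\int_G f(x)\overline{\langle x,\gamma\rangle}\,d\mu(x)$ for $\gamma\in\widehat{G}$. A Borel measure $\nu$ on $\widehat{G}$ is a $(p,q)$-frame measure for $\mu$ with frame bounds $A,B$ if $0<A\le B<\infty$ and $A\|f\|_{L^p(\mu)}^q\le\|\widehat{fd\mu}\|_{L^q(\nu)}^q\le B\|f\|_{L^p(\mu)}^q$ for all $f\in L^p(\mu)$, where $\|g\|_{L^q(\nu)}^q=\int_{\widehat{G}}|g(\gamma)|^q\,d\nu(\gamma)$.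
   Formalization: The formal theorem assumes that λ is not the zero measure and, when D>0, that the transform of f dλ has finite L^q(ν) norm for every f in L^p(λ); otherwise the inequality can read ∞≤∞ and the claim fails (e.g. for λ singular on the real line). *)

theory Defs
  imports "HOL-Analysis.Analysis"
begin

section \<open>The dual group as a topological space\<close>

typedef (overloaded) ('a::topological_ab_group_add) dual =
  "{\<gamma> :: 'a \<Rightarrow> complex. continuous_on UNIV \<gamma> \<and> (\<forall>x. cmod (\<gamma> x) = 1)
      \<and> (\<forall>x y. \<gamma> (x + y) = \<gamma> x * \<gamma> y)}"
  morphisms char_val Abs_dual
  by (rule exI[of _ "\<lambda>_. 1"]) auto

text \<open>The topology is the compact-open topology. Only the topology (and the Borel sets it
  generates) is needed below, not the pointwise group operation.\<close>

instantiation dual :: (topological_ab_group_add) topological_space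
begin

definition open_dual :: "'a dual set \<Rightarrow> bool" where
  "open_dual = generate_topology
     {{\<gamma>. char_val \<gamma> ` K \<subseteq> U} | K U. compact K \<and> open U}"

instance
  by standard
    (auto simp: open_dual_def intro: generate_topology.UNIV generate_topology.Int
      generate_topology.UN)

end

definition sigma_compact_space :: "'a::topological_space itself \<Rightarrow> bool" where
  "sigma_compact_space _ \<longleftrightarrow> (\<exists>K :: nat \<Rightarrow> 'a set. (\<forall>n. compact (K n)) \<and> (\<Union>n. K n) = UNIV)"


section \<open>Lebesgue spaces and their operators\<close>

text \<open>The extended-valued functional; it is infinite exactly when the integral is.\<close>

definition eLp_norm :: "real \<Rightarrow> 'b measure \<Rightarrow> ('b \<Rightarrow> complex) \<Rightarrow> ennreal" where
  "eLp_norm p M f =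
     (let I = \<integral>\<^sup>+x. ennreal (cmod (f x) powr p) \<partial>M
      in if I = \<infinity> then \<infinity> else ennreal (enn2real I powr (1 / p)))"

definition Lp_norm :: "real \<Rightarrow> 'b measure \<Rightarrow> ('b \<Rightarrow> complex) \<Rightarrow> real" where
  "Lp_norm p M f = enn2real (eLp_norm p M f)"

definition Lp_space :: "real \<Rightarrow> 'b measure \<Rightarrow> ('b \<Rightarrow> complex) set" where
  "Lp_space p M = {f \<in> borel_measurable M. eLp_norm p M f < \<infinity>}"

text \<open>Elements of \<open>L\<^sup>p\<close> are handled through representatives: an operator acts on functions,
  respects almost-everywhere equality, and all its identities hold almost everywhere.\<close>

definition Lp_operator ::
  "real \<Rightarrow> 'b measure \<Rightarrow> 'c measure \<Rightarrow> (('b \<Rightarrow> complex) \<Rightarrow> ('c \<Rightarrow> complex)) \<Rightarrow> bool" where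
  "Lp_operator p M N S \<longleftrightarrow>
     (\<forall>f \<in> Lp_space p M. S f \<in> Lp_space p N) \<and>
     (\<forall>f \<in> Lp_space p M. \<forall>g \<in> Lp_space p M.
        (AE x in M. f x = g x) \<longrightarrow> (AE y in N. S f y = S g y)) \<and>
     (\<forall>f \<in> Lp_space p M. \<forall>g \<in> Lp_space p M.
        AE y in N. S (\<lambda>x. f x + g x) y = S f y + S g y) \<and>
     (\<forall>c. \<forall>f \<in> Lp_space p M. AE y in N. S (\<lambda>x. c * f x) y = c * S f y)"

definition Lp_bounded_operator ::
  "real \<Rightarrow> 'b measure \<Rightarrow> 'c measure \<Rightarrow> (('b \<Rightarrow> complex) \<Rightarrow> ('c \<Rightarrow> complex)) \<Rightarrow> bool" where
  "Lp_bounded_operator p M N S \<longleftrightarrow>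
     Lp_operator p M N S \<and> (\<exists>K. \<forall>f \<in> Lp_space p M. Lp_norm p N (S f) \<le> K * Lp_norm p M f)"

text \<open>As for \<^const>\<open>onorm\<close>, the quotient is \<open>0\<close> when \<open>f\<close> vanishes almost everywhere.\<close>

definition Lp_onorm ::
  "real \<Rightarrow> 'b measure \<Rightarrow> 'c measure \<Rightarrow> (('b \<Rightarrow> complex) \<Rightarrow> ('c \<Rightarrow> complex)) \<Rightarrow> real" where
  "Lp_onorm p M N S = (SUP f \<in> Lp_space p M. Lp_norm p N (S f) / Lp_norm p M f)"

definition Lp_inverse_operator ::
  "real \<Rightarrow> 'b measure \<Rightarrow> 'c measure \<Rightarrow> (('b \<Rightarrow> complex) \<Rightarrow> ('c \<Rightarrow> complex))
     \<Rightarrow> (('c \<Rightarrow> complex) \<Rightarrow> ('b \<Rightarrow> complex)) \<Rightarrow> bool" where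
  "Lp_inverse_operator p M N S T \<longleftrightarrow>
     Lp_bounded_operator p N M T \<and>
     (\<forall>f \<in> Lp_space p M. AE x in M. T (S f) x = f x) \<and>
     (\<forall>g \<in> Lp_space p N. AE y in N. S (T g) y = g y)"


section \<open>Frame measures\<close>

definition fourier ::
  "'a::topological_ab_group_add measure \<Rightarrow> ('a \<Rightarrow> complex) \<Rightarrow> 'a dual \<Rightarrow> complex" where
  "fourier \<mu> f \<gamma> = (\<integral>x. f x * cnj (char_val \<gamma> x) \<partial>\<mu>)"

definition frame_measure ::
  "real \<Rightarrow> real \<Rightarrow> 'a::topological_ab_group_add measure \<Rightarrow> 'a dual measure
     \<Rightarrow> real \<Rightarrow> real \<Rightarrow> bool" where
  "frame_measure p q \<mu> \<nu> A B \<longleftrightarrow>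
     0 < A \<and> A \<le> B \<and>
     (\<forall>f \<in> Lp_space p \<mu>.
        ennreal (A * Lp_norm p \<mu> f powr q)
          \<le> (\<integral>\<^sup>+\<gamma>. ennreal (cmod (fourier \<mu> f \<gamma>) powr q) \<partial>\<nu>) \<and>
        (\<integral>\<^sup>+\<gamma>. ennreal (cmod (fourier \<mu> f \<gamma>) powr q) \<partial>\<nu>)
          \<le> ennreal (B * Lp_norm p \<mu> f powr q))"

end

theory Submission
  imports Defs
begin

text \<open>Compare the \<open>L\<^sup>q(\<nu>)\<close> norms \<open>a\<close>, \<open>x\<close> of the transforms of \<open>S f\<close> and \<open>f\<close>. Minkowski's
  inequality turns the hypothesis into \<open>(1 - D) x \<le> (1 + C) a + M \<parallel>f\<parallel>\<close> and
  \<open>(1 + D) x \<ge> (1 - C) a - M \<parallel>f\<parallel>\<close>; the frame inequality for \<open>\<mu>\<close> and the operator norms of \<open>S\<close>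
  and its inverse control \<open>a\<close> from both sides by \<open>\<parallel>f\<parallel>\<close>. Minkowski's inequality needs
  transforms that are measurable on the dual group; they are continuous there because a finite
  measure on a \<open>\<sigma>\<close>-compact space has small mass off some compact set.\<close>

section \<open>Lebesgue norms\<close>

text \<open>Convexity of the power is applied only to positive arguments. If \<open>x\<close> or
  \<open>y\<close> is 0, the claim reduces to \<open>(s * z) powr q \<le> s * z powr q\<close>,
  which holds since \<open>s powr q \<le> s\<close> for \<open>s\<close> in the unit
  interval.\<close>

lemma powr_convex_comb:
  fixes t x y q :: real
  assumes "1 \<le> q" "0 \<le> t" "t \<le> 1" "0 \<le> x" "0 \<le> y"
  shows "((1 - t) * x + t * y) powr q \<le> (1 - t) * x powr q + t * y powr q"
proof -
  have scale: "(s * z) powr q \<le> s * z powr q" if "0 \<le> s" "s \<le> 1" "0 \<le> z" for s z :: real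
  proof -
    have "s powr q \<le> s powr 1"
      using that assms(1) by (intro powr_mono') auto
    then show ?thesis
      using that powr_mult[of s z q] mult_right_mono[of "s powr q" s "z powr q"] by simp
  qed
  consider "x = 0" | "y = 0" | "0 < x" "0 < y" using assms by linarith
  then show ?thesis
  proof cases
    case 1 then show ?thesis using scale[of t y] assms by simp
  next
    case 2 then show ?thesis using scale[of "1 - t" x] assms by simp
  next
    case 3
    then show ?thesis
      using convex_onD[OF powr_convex[OF assms(1)], of t x y] assms by simp
  qed
qed

text \<open>\<open>(a + b) / (\<alpha> + \<beta>)\<close> is the mean of \<open>a / \<alpha>\<close>
  and \<open>b / \<beta>\<close> with weights proportional to \<open>\<alpha>\<close> and
  \<open>\<beta>\<close>, so convexity applies.\<close>

lemma powr_add_le_weighted: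
  fixes a b \<alpha> \<beta> q :: real
  assumes "1 \<le> q" "0 \<le> a" "0 \<le> b" "0 < \<alpha>" "0 < \<beta>"
  shows "(a + b) powr q \<le>
    (\<alpha> + \<beta>) powr q * (\<alpha> / (\<alpha> + \<beta>) * (a powr q / \<alpha> powr q) + \<beta> / (\<alpha> + \<beta>) * (b powr q / \<beta> powr q))"
proof -
  define t where "t = \<beta> / (\<alpha> + \<beta>)"
  have t: "0 \<le> t" "t \<le> 1" "1 - t = \<alpha> / (\<alpha> + \<beta>)"
    using assms by (auto simp: t_def field_simps)
  have "(1 - t) * (a / \<alpha>) + t * (b / \<beta>) = (a + b) / (\<alpha> + \<beta>)"
    using assms unfolding t(3) unfolding t_def by (simp add: add_divide_distrib)
  then have "((a + b) / (\<alpha> + \<beta>)) powr q \<le> (1 - t) * (a / \<alpha>) powr q + t * (b / \<beta>) powr q"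
    using powr_convex_comb[of q t "a / \<alpha>" "b / \<beta>"] assms t by simp
  then show ?thesis
    using assms unfolding t(3) unfolding t_def
    by (simp add: powr_divide pos_divide_le_eq mult.commute)
qed

section \<open>Norms and their defining integrals\<close>

lemma eLp_norm_finite_iff:
  "eLp_norm p M f < \<infinity> \<longleftrightarrow> (\<integral>\<^sup>+x. ennreal (cmod (f x) powr p) \<partial>M) < \<infinity>"
  by (auto simp: eLp_norm_def Let_def top.not_eq_extremum)

lemma Lp_norm_nonneg: "0 \<le> Lp_norm p M f"
  by (simp add: Lp_norm_def)

text \<open>Finiteness matters: \<open>enn2real\<close> sends infinity to 0, so a function with
  infinite integral has \<open>Lp_norm\<close> 0.\<close>

lemma Lp_norm_powr:
  assumes "0 < p" "eLp_norm p M f < \<infinity>"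
  shows "(\<integral>\<^sup>+x. ennreal (cmod (f x) powr p) \<partial>M) = ennreal (Lp_norm p M f powr p)"
  using assms(2) unfolding eLp_norm_finite_iff
  using assms(1) by (simp add: Lp_norm_def eLp_norm_def Let_def powr_powr top.not_eq_extremum)

lemma eLp_norm_eq_Lp_norm:
  "eLp_norm p M f < \<infinity> \<Longrightarrow> eLp_norm p M f = ennreal (Lp_norm p M f)"
  by (simp add: Lp_norm_def)

lemma Lp_norm_leI:
  assumes "0 < p" "0 \<le> r" "(\<integral>\<^sup>+x. ennreal (cmod (f x) powr p) \<partial>M) \<le> ennreal (r powr p)"
  shows "eLp_norm p M f < \<infinity>" "Lp_norm p M f \<le> r"
proof -
  show fin: "eLp_norm p M f < \<infinity>"
    unfolding eLp_norm_finite_iff using assms(3) by (auto intro: le_less_trans)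
  have "Lp_norm p M f powr p \<le> r powr p"
    using assms(3) unfolding Lp_norm_powr[OF assms(1) fin] by simp
  then show "Lp_norm p M f \<le> r"
    using assms powr_less_mono2[of p r "Lp_norm p M f"] by (meson not_le)
qed

lemma eLp_norm_cong_AE:
  assumes "AE x in M. f x = g x"
  shows "eLp_norm p M f = eLp_norm p M g"
proof -
  have "(\<integral>\<^sup>+x. ennreal (cmod (f x) powr p) \<partial>M) = (\<integral>\<^sup>+x. ennreal (cmod (g x) powr p) \<partial>M)"
    using assms by (intro nn_integral_cong_AE) auto
  then show ?thesis by (simp add: eLp_norm_def)
qed

lemma Lp_norm_cong_AE: "AE x in M. f x = g x \<Longrightarrow> Lp_norm p M f = Lp_norm p M g"
  unfolding Lp_norm_def by (metis eLp_norm_cong_AE)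

text \<open>The weights \<open>\<alpha> > \<parallel>f\<parallel>\<close> and \<open>\<beta> > \<parallel>g\<parallel>\<close> in the convexity inequality take the
  place of Hoelder's inequality and avoid a separate treatment of vanishing norms.\<close>

lemma Lp_norm_triangle:
  assumes "1 \<le> p" "f \<in> Lp_space p M" "g \<in> Lp_space p M"
    and le: "\<And>x. cmod (h x) \<le> cmod (f x) + cmod (g x)"
  shows "eLp_norm p M h < \<infinity>" "Lp_norm p M h \<le> Lp_norm p M f + Lp_norm p M g"
proof -
  have p: "0 < p" using assms by simp
  have f[measurable]: "f \<in> borel_measurable M" and ffin: "eLp_norm p M f < \<infinity>"
    and g[measurable]: "g \<in> borel_measurable M" and gfin: "eLp_norm p M g < \<infinity>"
    using assms by (auto simp: Lp_space_def)
  have bound: "eLp_norm p M h < \<infinity> \<and> Lp_norm p M h \<le> \<alpha> + \<beta>"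
    if \<alpha>: "Lp_norm p M f < \<alpha>" and \<beta>: "Lp_norm p M g < \<beta>" for \<alpha> \<beta>
  proof -
    have pos: "0 < \<alpha>" "0 < \<beta>"
      using that Lp_norm_nonneg[of p M f] Lp_norm_nonneg[of p M g] by linarith+
    \<comment> \<open>\<open>u\<close> and \<open>v\<close> are the coefficients of the two powers
      in the weighted inequality; replacing the norms by \<open>\<alpha>\<close> and
      \<open>\<beta>\<close> then gives exactly \<open>(\<alpha> + \<beta>) powr p\<close>.\<close>
    define u where "u = (\<alpha> + \<beta>) powr p * (\<alpha> / (\<alpha> + \<beta>)) / \<alpha> powr p"
    define v where "v = (\<alpha> + \<beta>) powr p * (\<beta> / (\<alpha> + \<beta>)) / \<beta> powr p"
    have uv: "0 \<le> u" "0 \<le> v" using pos by (auto simp: u_def v_def)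
    have "\<alpha> / (\<alpha> + \<beta>) + \<beta> / (\<alpha> + \<beta>) = 1"
      using pos by (simp add: add_divide_distrib[symmetric])
    moreover have "u * \<alpha> powr p + v * \<beta> powr p
        = (\<alpha> + \<beta>) powr p * (\<alpha> / (\<alpha> + \<beta>) + \<beta> / (\<alpha> + \<beta>))"
      using pos unfolding u_def v_def by (simp add: distrib_left)
    ultimately have sum: "u * \<alpha> powr p + v * \<beta> powr p = (\<alpha> + \<beta>) powr p"
      by simp
    have "(\<integral>\<^sup>+x. ennreal (cmod (h x) powr p) \<partial>M)
        \<le> (\<integral>\<^sup>+x. ennreal u * ennreal (cmod (f x) powr p) + ennreal v * ennreal (cmod (g x) powr p) \<partial>M)"
    proof (intro nn_integral_mono)
      fix x
      have "cmod (h x) powr p \<le> (cmod (f x) + cmod (g x)) powr p"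
        using le p by (intro powr_mono2) auto
      also have "\<dots> \<le> u * cmod (f x) powr p + v * cmod (g x) powr p"
        using powr_add_le_weighted[of p "cmod (f x)" "cmod (g x)" \<alpha> \<beta>] assms(1) pos
        by (simp add: u_def v_def algebra_simps)
      finally show "ennreal (cmod (h x) powr p)
          \<le> ennreal u * ennreal (cmod (f x) powr p) + ennreal v * ennreal (cmod (g x) powr p)"
        using uv by (simp flip: ennreal_mult ennreal_plus add: ennreal_leI)
    qed
    also have "\<dots> = ennreal u * ennreal (Lp_norm p M f powr p) + ennreal v * ennreal (Lp_norm p M g powr p)"
      using Lp_norm_powr[OF p ffin] Lp_norm_powr[OF p gfin]
      by (simp add: nn_integral_add nn_integral_cmult)
    also have "\<dots> \<le> ennreal u * ennreal (\<alpha> powr p) + ennreal v * ennreal (\<beta> powr p)"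
      using \<alpha> \<beta> p Lp_norm_nonneg
      by (intro add_mono mult_left_mono ennreal_leI powr_mono2) (auto intro: less_imp_le)
    also have "\<dots> = ennreal ((\<alpha> + \<beta>) powr p)"
      using uv sum by (simp flip: ennreal_mult ennreal_plus)
    finally show ?thesis
      using Lp_norm_leI[OF p, of "\<alpha> + \<beta>" M h] pos by simp
  qed
  show "eLp_norm p M h < \<infinity>"
    using bound[of "Lp_norm p M f + 1" "Lp_norm p M g + 1"] by simp
  show "Lp_norm p M h \<le> Lp_norm p M f + Lp_norm p M g"
  \<comment> \<open>The weights have to lie strictly above the norms, so each gets a slack of
    \<open>e / 2\<close>.\<close>
  proof (rule field_le_epsilon)
    fix e :: real assume "0 < e"
    then show "Lp_norm p M h \<le> Lp_norm p M f + Lp_norm p M g + e"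
      using bound[of "Lp_norm p M f + e / 2" "Lp_norm p M g + e / 2"] by simp
  qed
qed

section \<open>Null functions, integrability and constants\<close>

lemma Lp_norm_eq_0_imp_AE:
  assumes "0 < p" "f \<in> Lp_space p M" "Lp_norm p M f = 0"
  shows "AE x in M. f x = 0"
proof -
  have [measurable]: "f \<in> borel_measurable M" and fin: "eLp_norm p M f < \<infinity>"
    using assms by (auto simp: Lp_space_def)
  have "(\<integral>\<^sup>+x. ennreal (cmod (f x) powr p) \<partial>M) = 0"
    using Lp_norm_powr[OF assms(1) fin] assms by simp
  then show ?thesis
    by (subst (asm) nn_integral_0_iff_AE) auto
qed

text \<open>Constants are integrable for a finite measure, and
  \<open>cmod (f x) \<le> 1 + cmod (f x) powr p\<close> because the power dominates once
  \<open>cmod (f x)\<close> exceeds 1.\<close>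

lemma Lp_space_imp_integrable:
  assumes "1 \<le> p" "finite_measure M" "f \<in> Lp_space p M"
  shows "integrable M f"
proof (rule integrableI_bounded)
  show [measurable]: "f \<in> borel_measurable M" using assms by (auto simp: Lp_space_def)
  have "(\<integral>\<^sup>+x. ennreal (norm (f x)) \<partial>M) \<le> (\<integral>\<^sup>+x. 1 + ennreal (cmod (f x) powr p) \<partial>M)"
  proof (intro nn_integral_mono)
    fix x
    have "cmod (f x) \<le> 1 + cmod (f x) powr p"
    proof (cases "cmod (f x) \<le> 1")
      case False
      then have "cmod (f x) powr 1 \<le> cmod (f x) powr p" using assms(1) by (intro powr_mono) auto
      then show ?thesis using False by simp
    qed (simp add: add_increasing2)
    then have "ennreal (cmod (f x)) \<le> ennreal (1 + cmod (f x) powr p)" by (rule ennreal_leI)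
    then show "ennreal (norm (f x)) \<le> 1 + ennreal (cmod (f x) powr p)" by simp
  qed
  also have "\<dots> = emeasure M (space M) + (\<integral>\<^sup>+x. ennreal (cmod (f x) powr p) \<partial>M)"
    by (subst nn_integral_add) auto
  also have "\<dots> < \<infinity>"
    using assms(3) finite_measure.emeasure_finite[OF assms(2)]
    unfolding Lp_space_def eLp_norm_finite_iff by (simp add: less_top)
  finally show "(\<integral>\<^sup>+x. ennreal (norm (f x)) \<partial>M) < \<infinity>" .
qed

lemma Lp_space_const:
  assumes "finite_measure M"
  shows "(\<lambda>_. c) \<in> Lp_space p M"
  using finite_measure.emeasure_finite[OF assms]
  unfolding Lp_space_def eLp_norm_finite_iff by (simp add: ennreal_mult_less_top less_top)

text \<open>The constant 1 is the test function that later makes the operator norms positive and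
  orders the two frame bounds.\<close>

lemma Lp_norm_one_pos:
  assumes "0 < p" "finite_measure M" "emeasure M (space M) \<noteq> 0"
  shows "0 < Lp_norm p M (\<lambda>_. 1)"
proof (rule ccontr)
  assume "\<not> 0 < Lp_norm p M (\<lambda>_. 1)"
  then have "Lp_norm p M (\<lambda>_. 1) = 0" using Lp_norm_nonneg[of p M] by (simp add: order.antisym)
  then have "AE x in M. (1::complex) = 0"
    using Lp_norm_eq_0_imp_AE[OF assms(1) Lp_space_const[OF assms(2)]] by blast
  then have "ae_filter M = bot" by (simp add: eventually_False)
  then show False using assms(3) by (simp add: ae_filter_eq_bot_iff)
qed

text \<open>Boundedness of the operator bounds the quotients, so their supremum is an upper bound.
  Where \<open>f\<close> has norm 0 the quotient is 0 by convention and carries no information;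
  there \<open>K\<close> itself forces \<open>S f\<close> to have norm 0.\<close>

lemma Lp_norm_operator_le:
  assumes "0 < p" "Lp_bounded_operator p M N S" "f \<in> Lp_space p M"
  shows "Lp_norm p N (S f) \<le> Lp_onorm p M N S * Lp_norm p M f"
proof -
  obtain K where K: "\<And>f. f \<in> Lp_space p M \<Longrightarrow> Lp_norm p N (S f) \<le> K * Lp_norm p M f"
    using assms by (auto simp: Lp_bounded_operator_def)
  show ?thesis
  proof (cases "Lp_norm p M f = 0")
    case True
    then show ?thesis using K[OF assms(3)] by simp
  next
    case False
    \<comment> \<open>The sign of \<open>K\<close> is unknown, while a quotient with zero
      denominator equals 0, so the common bound has to be nonnegative.\<close>
    have "Lp_norm p N (S g) / Lp_norm p M g \<le> \<bar>K\<bar>" if "g \<in> Lp_space p M" for g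
    proof (cases "Lp_norm p M g = 0")
      case False
      then have "0 < Lp_norm p M g" using Lp_norm_nonneg[of p M g] by linarith
      moreover have "K * Lp_norm p M g \<le> \<bar>K\<bar> * Lp_norm p M g"
        by (intro mult_right_mono) (auto simp: Lp_norm_nonneg)
      ultimately show ?thesis using K[OF that] order_trans by (subst pos_divide_le_eq) blast+
    qed simp
    then have "bdd_above ((\<lambda>g. Lp_norm p N (S g) / Lp_norm p M g) ` Lp_space p M)"
      by (intro bdd_aboveI2)
    then have "Lp_norm p N (S f) / Lp_norm p M f \<le> Lp_onorm p M N S"
      unfolding Lp_onorm_def using assms(3) by (intro cSUP_upper)
    moreover have "0 < Lp_norm p M f" using False Lp_norm_nonneg[of p M f] by linarith
    ultimately show ?thesis by (simp add: pos_divide_le_eq)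
  qed
qed

section \<open>Continuity of the Fourier transform\<close>

lemma continuous_on_char_val: "continuous_on UNIV (char_val \<gamma>)"
  and norm_char_val [simp]: "cmod (char_val \<gamma> x) = 1"
  using char_val[of \<gamma>] by auto

text \<open>Compact-open neighbourhoods contain the neighbourhoods of uniform convergence on compact
  sets: cut \<open>K\<close> into finitely many compact pieces on which \<open>\<gamma>0\<close> is nearly constant.\<close>

lemma open_dual_uniform_nhd:
  fixes K :: "'a::{topological_ab_group_add, t2_space} set"
  assumes "compact K" "0 < e"
  shows "\<exists>V. open V \<and> \<gamma>0 \<in> V \<and> (\<forall>\<gamma>\<in>V. \<forall>x\<in>K. dist (char_val \<gamma> x) (char_val \<gamma>0 x) < e)"
proof -
  have cpt: "compact (char_val \<gamma>0 ` K)"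
    using assms(1) continuous_on_char_val by (blast intro: compact_continuous_image continuous_on_subset)
  have cover: "char_val \<gamma>0 ` K \<subseteq> (\<Union>z\<in>UNIV. ball z (e / 3))"
  proof
    fix w assume "w \<in> char_val \<gamma>0 ` K"
    have "w \<in> ball w (e / 3)" using assms(2) by simp
    then show "w \<in> (\<Union>z\<in>UNIV. ball z (e / 3))" by blast
  qed
  obtain Z where Z: "finite Z" "char_val \<gamma>0 ` K \<subseteq> (\<Union>z\<in>Z. ball z (e / 3))"
    by (rule compactE_image[OF cpt open_ball cover])
  \<comment> \<open>Closed balls keep the pieces compact. The radii fit:
    \<open>e / 3 < e / 2\<close> puts \<open>\<gamma>0\<close> into \<open>V\<close>, and
    \<open>e / 2 + e / 3 < e\<close> gives the final estimate.\<close>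
  define P where "P z = K \<inter> char_val \<gamma>0 -` cball z (e / 3)" for z
  define V where "V = (\<Inter>z\<in>Z. {\<gamma>. char_val \<gamma> ` P z \<subseteq> ball z (e / 2)})"
  have cP: "compact (P z)" for z
    unfolding P_def using assms(1) continuous_on_char_val
    by (intro compact_Int_closed closed_vimage) auto
  have "open {\<gamma>. char_val \<gamma> ` P z \<subseteq> ball z (e / 2)}" for z
    unfolding open_dual_def using cP by (intro generate_topology.Basis) blast
  then have "open V" unfolding V_def using Z(1) by auto
  moreover have "\<gamma>0 \<in> V"
    using assms(2) by (auto simp: V_def P_def)
  moreover have "dist (char_val \<gamma> x) (char_val \<gamma>0 x) < e" if \<gamma>: "\<gamma> \<in> V" and x: "x \<in> K" for \<gamma> x
  proof -
    obtain z where z: "z \<in> Z" "dist z (char_val \<gamma>0 x) < e / 3"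
      using Z(2) x by auto
    then have "x \<in> P z" using x by (simp add: P_def)
    then have "dist z (char_val \<gamma> x) < e / 2" using \<gamma> z(1) by (force simp: V_def)
    then show ?thesis
      using z(2) dist_triangle2[of "char_val \<gamma> x" "char_val \<gamma>0 x" z] assms(2)
      by (simp add: dist_commute)
  qed
  ultimately show ?thesis by blast
qed

text \<open>Along an increasing exhaustion by compact sets, the integrand cut off to the complement
  eventually vanishes at each point and is dominated by \<open>cmod (f x)\<close>, so dominated
  convergence applies.\<close>

lemma integral_small_off_compact:
  fixes \<mu> :: "'a::t2_space measure" and f :: "'a \<Rightarrow> complex"
  assumes "sigma_compact_space TYPE('a)" "sets \<mu> = sets borel" "integrable \<mu> f" "0 < e"
  shows "\<exists>K. compact K \<and> (\<integral>x. indicator (- K) x * cmod (f x) \<partial>\<mu>) < e"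
proof -
  obtain L :: "nat \<Rightarrow> 'a set" where L: "\<And>n. compact (L n)" "(\<Union>n. L n) = UNIV"
    using assms(1) by (auto simp: sigma_compact_space_def)
  \<comment> \<open>Finite unions make the sequence increasing, so that a point once covered stays
    covered.\<close>
  define K where "K n = (\<Union>i\<le>n. L i)" for n
  have K: "compact (K n)" for n
    unfolding K_def using L(1) by (intro compact_UN) auto
  then have [measurable]: "- K n \<in> sets \<mu>" for n
    unfolding assms(2) using compact_imp_closed by (intro borel_open) (auto simp: closed_def)
  have [measurable]: "f \<in> borel_measurable \<mu>" using assms(3) by auto
  have "(\<lambda>n. \<integral>x. indicator (- K n) x * cmod (f x) \<partial>\<mu>) \<longlonglongrightarrow> (\<integral>x. 0 \<partial>\<mu>)"
  proof (rule integral_dominated_convergence[where w = "\<lambda>x. cmod (f x)"])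
    show "AE x in \<mu>. (\<lambda>n. indicator (- K n) x * cmod (f x)) \<longlonglongrightarrow> 0"
    proof (rule AE_I2)
      fix x
      obtain m where "x \<in> L m" using L(2) by auto
      then have "\<And>n. m \<le> n \<Longrightarrow> x \<in> K n" by (auto simp: K_def)
      then have "eventually (\<lambda>n. indicator (- K n) x * cmod (f x) = 0) sequentially"
        by (auto simp: eventually_sequentially intro!: exI[of _ m])
      then show "(\<lambda>n. indicator (- K n) x * cmod (f x)) \<longlonglongrightarrow> 0" by (rule tendsto_eventually)
    qed
  next
    show "(\<lambda>x. indicator (- K n) x * cmod (f x)) \<in> borel_measurable \<mu>" for n
      by measurable
  qed (use assms(3) in \<open>auto simp: indicator_def\<close>)
  then have "eventually (\<lambda>n. (\<integral>x. indicator (- K n) x * cmod (f x) \<partial>\<mu>) < e) sequentially"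
    using assms(4) by (intro order_tendstoD) auto
  then show ?thesis using K by (auto simp: eventually_sequentially)
qed

lemma integrable_fourier:
  assumes "sets \<mu> = sets borel" "integrable \<mu> f"
  shows "integrable \<mu> (\<lambda>x. f x * cnj (char_val \<gamma> x))"
proof (rule Bochner_Integration.integrable_bound[OF assms(2)])
  have "(\<lambda>x. cnj (char_val \<gamma> x)) \<in> borel_measurable borel"
    using continuous_on_char_val by (intro borel_measurable_continuous_onI continuous_on_cnj)
  then have [measurable]: "(\<lambda>x. cnj (char_val \<gamma> x)) \<in> borel_measurable \<mu>"
    using assms(1) measurable_cong_sets by blast
  have [measurable]: "f \<in> borel_measurable \<mu>" using assms by auto
  show "(\<lambda>x. f x * cnj (char_val \<gamma> x)) \<in> borel_measurable \<mu>"
    by measurable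
qed (simp add: norm_mult)

text \<open>Two characters differ by at most 2 everywhere, and by less than \<open>d\<close> on a
  compact \<open>K\<close> if they are close in the compact-open topology. Choosing \<open>K\<close>
  with little mass of \<open>f\<close> outside it makes both contributions small.\<close>

lemma fourier_continuous_on:
  fixes \<mu> :: "'a::{topological_ab_group_add, t2_space} measure"
  assumes "sigma_compact_space TYPE('a)" "sets \<mu> = sets borel" "integrable \<mu> f"
  shows "continuous_on UNIV (fourier \<mu> f)"
proof -
  have "\<exists>V. open V \<and> \<gamma>0 \<in> V \<and> (\<forall>\<gamma>\<in>V. dist (fourier \<mu> f \<gamma>) (fourier \<mu> f \<gamma>0) < e)"
    if e: "0 < e" for \<gamma>0 e
  proof -
    have [measurable]: "f \<in> borel_measurable \<mu>" using assms(3) by auto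
    obtain K where K: "compact K" "(\<integral>x. indicator (- K) x * cmod (f x) \<partial>\<mu>) < e / 4"
      using integral_small_off_compact[OF assms, of "e / 4"] e by auto
    have [measurable]: "- K \<in> sets \<mu>"
      unfolding assms(2) using K(1) compact_imp_closed by (intro borel_open) (auto simp: closed_def)
    define I where "I = (\<integral>x. cmod (f x) \<partial>\<mu>)"
    have I: "0 \<le> I" by (simp add: I_def)
    \<comment> \<open>The added 1 keeps the denominator positive when \<open>I = 0\<close>. The term
      with factor \<open>d\<close> contributes less than \<open>e / 2\<close>, and so does the part
      off \<open>K\<close>, with factor 2 and mass below \<open>e / 4\<close>.\<close>
    define d where "d = e / (2 * (I + 1))"
    have d: "0 < d" "d * I < e / 2" using e I by (auto simp: d_def field_simps)
    obtain V where V: "open V" "\<gamma>0 \<in> V"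
      "\<And>\<gamma> x. \<gamma> \<in> V \<Longrightarrow> x \<in> K \<Longrightarrow> dist (char_val \<gamma> x) (char_val \<gamma>0 x) < d"
      using open_dual_uniform_nhd[OF K(1) d(1)] by metis
    have "dist (fourier \<mu> f \<gamma>) (fourier \<mu> f \<gamma>0) < e" if "\<gamma> \<in> V" for \<gamma>
    proof -
      let ?g = "\<lambda>x. f x * cnj (char_val \<gamma> x) - f x * cnj (char_val \<gamma>0 x)"
      have int: "integrable \<mu> ?g" using integrable_fourier[OF assms(2,3)] by auto
      have intK: "integrable \<mu> (\<lambda>x. indicator (- K) x * cmod (f x))"
        using assms(3) by (intro integrable_real_mult_indicator[OF _ integrable_norm, simplified mult.commute]) auto
      have "dist (fourier \<mu> f \<gamma>) (fourier \<mu> f \<gamma>0) = cmod (\<integral>x. ?g x \<partial>\<mu>)"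
        unfolding fourier_def dist_norm using integrable_fourier[OF assms(2,3)] by simp
      also have "\<dots> \<le> (\<integral>x. cmod (?g x) \<partial>\<mu>)" by (rule integral_norm_bound)
      also have "\<dots> \<le> (\<integral>x. d * cmod (f x) + 2 * (indicator (- K) x * cmod (f x)) \<partial>\<mu>)"
      proof (rule integral_mono)
        fix x
        have "cmod (?g x) = cmod (f x) * dist (char_val \<gamma> x) (char_val \<gamma>0 x)"
          unfolding dist_norm right_diff_distrib[symmetric] complex_cnj_diff[symmetric]
          by (simp only: norm_mult complex_mod_cnj)
        moreover have "dist (char_val \<gamma> x) (char_val \<gamma>0 x) \<le> d + 2 * indicator (- K) x"
        proof (cases "x \<in> K")
          case True then show ?thesis using V(3)[OF that, of x] by simp
        next
          case False
          then show ?thesis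
            using norm_triangle_ineq4[of "char_val \<gamma> x" "char_val \<gamma>0 x"] d(1) by (simp add: dist_norm)
        qed
        ultimately have "cmod (?g x) \<le> cmod (f x) * (d + 2 * indicator (- K) x)"
          by (simp add: mult_left_mono)
        then show "cmod (?g x) \<le> d * cmod (f x) + 2 * (indicator (- K) x * cmod (f x))"
          by (simp add: algebra_simps)
      qed (use int intK assms(3) in auto)
      also have "\<dots> = d * I + 2 * (\<integral>x. indicator (- K) x * cmod (f x) \<partial>\<mu>)"
        using intK assms(3) by (simp add: I_def)
      also have "\<dots> < e" using d K(2) by linarith
      finally show ?thesis .
    qed
    then show ?thesis using V(1,2) by blast
  qed
  then have "(fourier \<mu> f \<longlongrightarrow> fourier \<mu> f \<gamma>0) (nhds \<gamma>0)" for \<gamma>0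
    unfolding tendsto_iff eventually_nhds by blast
  then show ?thesis
    unfolding continuous_on_def by (blast intro: tendsto_mono[OF at_within_le_nhds])
qed

lemma fourier_borel_measurable:
  fixes \<mu> :: "'a::{topological_ab_group_add, t2_space} measure"
  assumes "sigma_compact_space TYPE('a)" "sets \<mu> = sets borel" "sets \<nu> = sets borel" "integrable \<mu> f"
  shows "fourier \<mu> f \<in> borel_measurable \<nu>"
  using borel_measurable_continuous_onI[OF fourier_continuous_on[OF assms(1,2,4)]] assms(3)
    measurable_cong_sets by blast

section \<open>Perturbation of frame measures\<close>

text \<open>Taking \<open>q\<close>-th roots makes the frame inequality linear in the norms. The
  upper bound gives finiteness, which lets the lower bound be read as one on
  \<open>Lp_norm\<close>.\<close>

lemma frame_measure_Lp_norm:
  assumes "frame_measure p q \<mu> \<nu> A B" "0 < q" "f \<in> Lp_space p \<mu>"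
  shows "eLp_norm q \<nu> (fourier \<mu> f) < \<infinity>"
    and "A powr (1/q) * Lp_norm p \<mu> f \<le> Lp_norm q \<nu> (fourier \<mu> f)"
    and "Lp_norm q \<nu> (fourier \<mu> f) \<le> B powr (1/q) * Lp_norm p \<mu> f"
proof -
  let ?I = "\<integral>\<^sup>+\<gamma>. ennreal (cmod (fourier \<mu> f \<gamma>) powr q) \<partial>\<nu>"
  have AB: "0 < A" "0 < B" using assms(1) by (auto simp: frame_measure_def)
  have eq: "(c powr (1/q) * Lp_norm p \<mu> f) powr q = c * Lp_norm p \<mu> f powr q" if "0 < c" for c
    using that assms(2) Lp_norm_nonneg[of p \<mu> f] by (simp add: powr_mult powr_powr)
  have lo: "ennreal (A * Lp_norm p \<mu> f powr q) \<le> ?I" and up: "?I \<le> ennreal (B * Lp_norm p \<mu> f powr q)"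
    using assms(1,3) by (auto simp: frame_measure_def)
  show fin: "eLp_norm q \<nu> (fourier \<mu> f) < \<infinity>"
    and "Lp_norm q \<nu> (fourier \<mu> f) \<le> B powr (1/q) * Lp_norm p \<mu> f"
    using Lp_norm_leI[OF assms(2), of "B powr (1/q) * Lp_norm p \<mu> f"] up
    by (auto simp: eq AB Lp_norm_nonneg)
  have "(A powr (1/q) * Lp_norm p \<mu> f) powr q \<le> Lp_norm q \<nu> (fourier \<mu> f) powr q"
    using lo unfolding Lp_norm_powr[OF assms(2) fin] eq[OF AB(1)] by simp
  then show "A powr (1/q) * Lp_norm p \<mu> f \<le> Lp_norm q \<nu> (fourier \<mu> f)"
    using powr_less_mono2[of q "Lp_norm q \<nu> (fourier \<mu> f)" "A powr (1/q) * Lp_norm p \<mu> f"]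
      assms(2) Lp_norm_nonneg[of q \<nu> "fourier \<mu> f"] by (meson not_le)
qed

text \<open>\<open>emeasure lam UNIV \<noteq> 0\<close> excludes the zero measure, for which
  \<open>Lp_onorm p \<mu> lam Sinv\<close> is 0 and the claimed lower bound would not be positive.
  The last hypothesis covers \<open>D > 0\<close>, where an infinite norm of
  \<open>fourier lam f\<close> makes the perturbation inequality vacuous.\<close>

theorem theorem3p9:
  fixes \<mu> lam :: "'a::{topological_ab_group_add, t2_space} measure"
    and \<nu> :: "'a dual measure"
    and S Sinv :: "('a \<Rightarrow> complex) \<Rightarrow> ('a \<Rightarrow> complex)"
    and p q A B C D M :: real
  assumes "locally_compact_space (euclidean :: 'a topology)"
    and "metrizable_space (euclidean :: 'a topology)"
    and "sigma_compact_space TYPE('a)"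
    and "1 < p" and "1 < q"
    and "finite_measure \<mu>" and "sets \<mu> = sets borel"
    and "finite_measure lam" and "sets lam = sets borel"
    and "emeasure lam UNIV \<noteq> 0"
    and "sets \<nu> = sets borel"
    and "frame_measure p q \<mu> \<nu> A B"
    and "Lp_bounded_operator p lam \<mu> S"
    and "Lp_inverse_operator p lam \<mu> S Sinv"
    and "0 \<le> C" and "0 \<le> D" and "0 \<le> M"
    and "max (C + M / (A powr (1/q) * inverse (Lp_onorm p \<mu> lam Sinv))) D < 1"
    and "\<And>f. f \<in> Lp_space p lam \<Longrightarrow>
           eLp_norm q \<nu> (\<lambda>\<gamma>. fourier \<mu> (S f) \<gamma> - fourier lam f \<gamma>)
             \<le> ennreal C * eLp_norm q \<nu> (fourier \<mu> (S f))
               + ennreal D * eLp_norm q \<nu> (fourier lam f)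
               + ennreal (M * Lp_norm p lam f)"
    and "\<And>f. f \<in> Lp_space p lam \<Longrightarrow> 0 < D \<Longrightarrow> eLp_norm q \<nu> (fourier lam f) < \<infinity>"
  shows "frame_measure p q lam \<nu>
           (A * Lp_onorm p \<mu> lam Sinv powr (- q)
              * (1 - (C + D + M / (A powr (1/q) * inverse (Lp_onorm p \<mu> lam Sinv))) / (1 + D)) powr q)
           (B * Lp_onorm p lam \<mu> S powr q
              * (1 + (C + D + M / (B powr (1/q) * Lp_onorm p lam \<mu> S)) / (1 - D)) powr q)"
proof -
  note S = assms(13) and Sinv = assms(14) and frame = assms(12)
  have p: "0 < p" and q: "0 < q" "1 \<le> q" using assms(4,5) by auto
  have AB: "0 < A" "0 < B" using frame by (auto simp: frame_measure_def)
  have T: "Lp_bounded_operator p \<mu> lam Sinv" using Sinv by (simp add: Lp_inverse_operator_def)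
  define s where "s = Lp_onorm p lam \<mu> S"
  define t where "t = Lp_onorm p \<mu> lam Sinv"
  \<comment> \<open>\<open>k\<close> and \<open>l\<close> are the factors that bound the norm of
    \<open>fourier \<mu> (S f)\<close> below and above by the norm of \<open>f\<close>;
    \<open>L\<close> and \<open>U\<close> are the \<open>q\<close>-th roots of the claimed frame
    bounds.\<close>
  define k where "k = A powr (1/q) * inverse t"
  define l where "l = B powr (1/q) * s"
  define L where "L = (1 - C - M / k) / (1 + D) * k"
  define U where "U = ((1 + C) * l + M) / (1 - D)"

  \<comment> \<open>Operator norm estimates\<close>
  have SL: "S f \<in> Lp_space p \<mu>" if "f \<in> Lp_space p lam" for f
    using S that by (auto simp: Lp_bounded_operator_def Lp_operator_def)
  have s: "Lp_norm p \<mu> (S f) \<le> s * Lp_norm p lam f" if "f \<in> Lp_space p lam" for f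
    unfolding s_def by (rule Lp_norm_operator_le[OF p S that])
  have t: "Lp_norm p lam f \<le> t * Lp_norm p \<mu> (S f)" if "f \<in> Lp_space p lam" for f
  proof -
    have "AE x in lam. Sinv (S f) x = f x" using Sinv that by (auto simp: Lp_inverse_operator_def)
    then have "Lp_norm p lam (Sinv (S f)) = Lp_norm p lam f" by (rule Lp_norm_cong_AE)
    then show ?thesis using Lp_norm_operator_le[OF p T SL[OF that]] by (simp add: t_def)
  qed
  define e where "e = Lp_norm p lam (\<lambda>_. 1)"
  have one: "(\<lambda>_. 1) \<in> Lp_space p lam" by (rule Lp_space_const[OF assms(8)])
  have "space lam = UNIV" using sets_eq_imp_space_eq[OF assms(9)] by simp
  then have e: "0 < e" unfolding e_def using Lp_norm_one_pos[OF p assms(8)] assms(10) by simp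
  \<comment> \<open>At the constant 1 the estimate reads
    \<open>e \<le> t * Lp_norm p \<mu> (S (\<lambda>_. 1))\<close>; the left side is positive and
    the second factor nonnegative, so both factors are positive.\<close>
  have tpos: "0 < t" "0 < Lp_norm p \<mu> (S (\<lambda>_. 1))"
    using t[OF one] e Lp_norm_nonneg[of p \<mu> "S (\<lambda>_. 1)"] unfolding e_def
    by (smt (verit) mult_nonneg_nonneg mult_nonpos_nonneg mult_eq_0_iff)+
  have spos: "0 < s"
    using s[OF one] tpos(2) e unfolding e_def by (smt (verit) mult_nonpos_nonneg)
  have k: "0 < k" using AB tpos by (simp add: k_def)
  have l: "0 < l" using AB spos by (simp add: l_def)
  have CM: "C + M / k < 1" and D: "0 \<le> D" "D < 1"
    using assms(16,18) by (auto simp: k_def t_def)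
  have C1: "C < 1" using CM k assms(17) by (smt (verit) divide_nonneg_pos)
  \<comment> \<open>Since \<open>k\<close> and \<open>1 + D\<close> are positive, this is exactly
    the smallness condition \<open>C + M / k < 1\<close>.\<close>
  have L: "0 < L" unfolding L_def using CM D k by (intro mult_pos_pos divide_pos_pos) auto
  have U: "0 < U" unfolding U_def using assms(15,17) l D
    by (intro divide_pos_pos add_pos_nonneg mult_pos_pos) auto

  \<comment> \<open>Two-sided estimate of the transform\<close>
  have bounds: "eLp_norm q \<nu> (fourier lam f) < \<infinity>
      \<and> L * Lp_norm p lam f \<le> Lp_norm q \<nu> (fourier lam f)
      \<and> Lp_norm q \<nu> (fourier lam f) \<le> U * Lp_norm p lam f" if f: "f \<in> Lp_space p lam" for f
  proof -
    let ?a = "fourier \<mu> (S f)" and ?x = "fourier lam f"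
    let ?d = "\<lambda>\<gamma>. ?a \<gamma> - ?x \<gamma>"
    let ?n = "Lp_norm p lam f"
    have meas: "?a \<in> borel_measurable \<nu>" "?x \<in> borel_measurable \<nu>"
      using fourier_borel_measurable[OF assms(3) assms(7) assms(11)]
        fourier_borel_measurable[OF assms(3) assms(9) assms(11)]
        Lp_space_imp_integrable[OF _ assms(6) SL[OF f]] Lp_space_imp_integrable[OF _ assms(8) f]
        assms(4) by simp_all
    note a = frame_measure_Lp_norm[OF frame q(1) SL[OF f]]
    have aL: "?a \<in> Lp_space q \<nu>" using meas a(1) by (simp add: Lp_space_def)
    \<comment> \<open>For \<open>D = 0\<close> both sides are 0, as 0 times infinity is 0 in
      \<open>ennreal\<close>; for \<open>D > 0\<close> the norm is finite by hypothesis.\<close>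
    have Dx: "ennreal D * eLp_norm q \<nu> ?x = ennreal (D * Lp_norm q \<nu> ?x)"
    proof (cases "D = 0")
      case False
      then have "eLp_norm q \<nu> ?x < \<infinity>" using assms(20)[OF f] D(1) by simp
      then show ?thesis using D(1) by (simp add: eLp_norm_eq_Lp_norm ennreal_mult Lp_norm_nonneg)
    qed simp
    have dle: "eLp_norm q \<nu> ?d \<le> ennreal (C * Lp_norm q \<nu> ?a + D * Lp_norm q \<nu> ?x + M * ?n)"
      using assms(19)[OF f] assms(15,17) D(1) unfolding Dx eLp_norm_eq_Lp_norm[OF a(1)]
      by (simp add: ennreal_mult ennreal_plus Lp_norm_nonneg)
    then have dfin: "eLp_norm q \<nu> ?d < \<infinity>" by (auto intro: le_less_trans)
    then have dL: "?d \<in> Lp_space q \<nu>" using meas by (simp add: Lp_space_def)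
    have d: "Lp_norm q \<nu> ?d \<le> C * Lp_norm q \<nu> ?a + D * Lp_norm q \<nu> ?x + M * ?n"
      using dle assms(15,17) D(1) unfolding eLp_norm_eq_Lp_norm[OF dfin]
      by (subst (asm) ennreal_le_iff) (auto simp: Lp_norm_nonneg)
    \<comment> \<open>Since \<open>?x\<close> is the difference of \<open>?a\<close> and
      \<open>?d\<close>, both of finite norm, its norm is finite also for \<open>D = 0\<close>,
      where this is not assumed.\<close>
    have x: "eLp_norm q \<nu> ?x < \<infinity>" "Lp_norm q \<nu> ?x \<le> Lp_norm q \<nu> ?a + Lp_norm q \<nu> ?d"
      using Lp_norm_triangle[OF q(2) aL dL, of ?x] norm_triangle_sub[of "?x _" "?a _"]
      by (auto simp: norm_minus_commute)
    then have xL: "?x \<in> Lp_space q \<nu>" using meas by (simp add: Lp_space_def)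
    have ax: "Lp_norm q \<nu> ?a \<le> Lp_norm q \<nu> ?x + Lp_norm q \<nu> ?d"
      using Lp_norm_triangle(2)[OF q(2) xL dL, of ?a] norm_triangle_sub[of "?a _" "?x _"] by auto
    have "B powr (1/q) * Lp_norm p \<mu> (S f) \<le> B powr (1/q) * (s * ?n)"
      using s[OF f] by (intro mult_left_mono) auto
    then have "Lp_norm q \<nu> ?a \<le> l * ?n" using a(3) by (simp add: l_def mult.assoc)
    then have "(1 + C) * Lp_norm q \<nu> ?a \<le> (1 + C) * (l * ?n)"
      using assms(15) by (intro mult_left_mono) auto
    \<comment> \<open>The term with factor \<open>D\<close> in the bound \<open>d\<close> is
      absorbed on the left; \<open>D < 1\<close> then permits division.\<close>
    then have "(1 - D) * Lp_norm q \<nu> ?x \<le> ((1 + C) * l + M) * ?n"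
      using x(2) d by (simp add: algebra_simps)
    then have up: "Lp_norm q \<nu> ?x \<le> U * ?n"
      using D by (simp add: U_def pos_le_divide_eq mult.commute)
    \<comment> \<open>The factor \<open>inverse t\<close> in \<open>k\<close> cancels the
      \<open>t\<close> of the estimate for the inverse and leaves the root of
      \<open>A\<close>.\<close>
    have "k * ?n \<le> k * (t * Lp_norm p \<mu> (S f))"
      using t[OF f] k by (intro mult_left_mono) auto
    moreover have "k * (t * Lp_norm p \<mu> (S f)) = A powr (1/q) * Lp_norm p \<mu> (S f)"
      using tpos(1) by (simp add: k_def)
    ultimately have "k * ?n \<le> Lp_norm q \<nu> ?a" using a(2) by simp
    then have "(1 - C) * (k * ?n) \<le> (1 - C) * Lp_norm q \<nu> ?a"
      using C1 by (intro mult_left_mono) auto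
    then have "((1 - C) * k - M) * ?n \<le> (1 + D) * Lp_norm q \<nu> ?x"
      using ax d by (simp add: algebra_simps)
    moreover have "L = ((1 - C) * k - M) / (1 + D)"
      using k by (simp add: L_def left_diff_distrib)
    ultimately have "L * ?n \<le> Lp_norm q \<nu> ?x"
      using D by (simp add: pos_divide_le_eq mult.commute)
    with x(1) up show ?thesis by simp
  qed

  \<comment> \<open>Form of the frame bounds\<close>
  have Aeq: "A * t powr (- q) * (1 - (C + D + M / k) / (1 + D)) powr q = L powr q"
  proof -
    have "1 - (C + D + M / k) / (1 + D) = (1 - C - M / k) / (1 + D)"
      using D by (simp add: field_simps)
    moreover have "k powr q = A * t powr (- q)"
      using AB tpos q(1) by (simp add: k_def powr_mult powr_powr powr_minus inverse_powr)
    \<comment> \<open>Nonnegative factors let the power distribute over the product.\<close>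
    moreover have "0 \<le> (1 - C - M / k) / (1 + D)" using CM D by simp
    ultimately show ?thesis
      using k powr_mult[of "(1 - C - M / k) / (1 + D)" k q] unfolding L_def by (simp only: mult.commute)
  qed
  have Beq: "B * s powr q * (1 + (C + D + M / l) / (1 - D)) powr q = U powr q"
  proof -
    have "U = l * (1 + (C + D + M / l) / (1 - D))"
      using D l by (simp add: U_def field_simps)
    moreover have "l powr q = B * s powr q"
      using AB spos q(1) by (simp add: l_def powr_mult powr_powr)
    moreover have "0 \<le> 1 + (C + D + M / l) / (1 - D)"
      using D l assms(15,17) by simp
    ultimately show ?thesis
      using l powr_mult[of l "1 + (C + D + M / l) / (1 - D)" q] by simp
  qed
  \<comment> \<open>A frame measure needs ordered bounds; comparing both estimates at the constant
    1, whose norm is positive, gives the order.\<close>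
  have "L * e \<le> U * e" using bounds[OF one] by (simp add: e_def)
  then have LU: "L \<le> U" using e by simp
  have "frame_measure p q lam \<nu> (L powr q) (U powr q)"
    unfolding frame_measure_def
  proof (intro conjI ballI)
    show "0 < L powr q" "L powr q \<le> U powr q"
      using L LU q by (auto intro: powr_mono2)
    fix f assume f: "f \<in> Lp_space p lam"
    note b = bounds[OF f]
    have I: "(\<integral>\<^sup>+\<gamma>. ennreal (cmod (fourier lam f \<gamma>) powr q) \<partial>\<nu>)
        = ennreal (Lp_norm q \<nu> (fourier lam f) powr q)"
      using Lp_norm_powr[OF q(1)] b by blast
    show "ennreal (L powr q * Lp_norm p lam f powr q)
        \<le> (\<integral>\<^sup>+\<gamma>. ennreal (cmod (fourier lam f \<gamma>) powr q) \<partial>\<nu>)"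
      unfolding I using b L q Lp_norm_nonneg[of p lam f]
      by (simp add: powr_mono2 flip: powr_mult)
    show "(\<integral>\<^sup>+\<gamma>. ennreal (cmod (fourier lam f \<gamma>) powr q) \<partial>\<nu>)
        \<le> ennreal (U powr q * Lp_norm p lam f powr q)"
      unfolding I using b U q Lp_norm_nonneg[of p lam f] Lp_norm_nonneg[of q \<nu> "fourier lam f"]
      by (intro ennreal_leI) (simp add: powr_mono2 flip: powr_mult)
  qed
  then show ?thesis
    unfolding Aeq[symmetric] Beq[symmetric] unfolding k_def l_def s_def t_def .
qed

end
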